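(* There exist absolute constants $C_1, C_2>0$ such that the following holds. Let $0<\alpha<1$ and let $m$ be a positive integer which is sufficiently large depending on $\alpha$. If $B\subseteq\mathbb{Z}_m^\ast$ satisfies $|B|\geq \alpha\varphi(m)$, then $$|B+B|\geq C_1\alpha\, e^{-C_2(\log(1/\alpha))^{2/3}(\log\log(1/\alpha))^{1/3}}\, m.$$
   Context: $\mathbb{Z}_m=\mathbb{Z}/m\mathbb{Z}$, and $\mathbb{Z}_m^\ast=\{x\in\mathbb{Z}_m : \gcd(x,m)=1\}$ is the set of residues coprime to $m$ (equivalently, the integers in $[0,m-1]$ coprime to $m$). $\varphi$ is Euler's totient function. $B+B=\{b+b' : b,b'\in B\}$, computed in $\mathbb{Z}_m$. *)

theory Defs
  imports Complex_Main "HOL-Number_Theory.Residues" "HOL-Number_Theory.Totient"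
begin

definition reduced_residues :: "nat \<Rightarrow> int set" where
  "reduced_residues m = {x \<in> carrier (residue_ring (int m)). coprime x (int m)}"

end

theory Submission
  imports Defs
begin

text \<open>
  The proof is an entropy argument. For independent random variables X, Y on the reduced residues
  modulo m put D(X) = ln \<phi>(m) - H(X) and let D'(X + Y) = ln m - H(X + Y). The chain rule along
  d \<mapsto> d p reduces an inequality D'(X + Y) \<le> a (D(X) + D(Y)) + \<Sum> c(p), with the sum over the
  primes p dividing m, to the case of a single prime, because X and Y remain independent after
  conditioning on both of their residues modulo d. For one prime, H(X + Y) \<ge> max (H(X)) (H(Y)) allows
  c(p) = ln (p / (p - 1)), whose sum over p \<le> P is at most ln P. Now let a = 1/2 + 1/L with
  L about ln (1/\<alpha>). For p > P of the order of L^4 there are two cases: either D(X) + D(Y) is so large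
  that the slack 1/L already pays for ln (p / (p - 1)), or X and Y are both nearly uniform, and then
  convolving makes the divergence from uniform quadratically small, so that c(p) = O(L^2 / p^(3/2))
  suffices. Taking X and Y uniform on B gives |B + B| \<ge> c \<alpha> m / L^4, which is stronger than required.
\<close>

section \<open>Convolution and entropy modulo n\<close>

text \<open>Functions on the integers modulo n are represented by n-periodic functions on the integers, so that
  shifts, convolutions and fibres need no reduction modulo n.\<close>

definition periodic_mod :: "int \<Rightarrow> (int \<Rightarrow> real) \<Rightarrow> bool" where
  "periodic_mod n f \<longleftrightarrow> (\<forall>x. f (x mod n) = f x)"

definition mass :: "int \<Rightarrow> (int \<Rightarrow> real) \<Rightarrow> real" where
  "mass n f = (\<Sum>x\<in>{0..<n}. f x)"

definition conv :: "int \<Rightarrow> (int \<Rightarrow> real) \<Rightarrow> (int \<Rightarrow> real) \<Rightarrow> int \<Rightarrow> real" where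
  "conv n f g z = (\<Sum>x\<in>{0..<n}. f x * g (z - x))"

text \<open>Homogeneous of degree one in f, so that conditional entropies are plain sums over fibres.\<close>

definition neg_ent :: "int \<Rightarrow> (int \<Rightarrow> real) \<Rightarrow> real" where
  "neg_ent n f = (\<Sum>x\<in>{0..<n}. f x * ln (f x / mass n f))"

lemma periodic_modD: "periodic_mod n f \<Longrightarrow> x mod n = y mod n \<Longrightarrow> f x = f y"
  unfolding periodic_mod_def by metis

lemma periodic_modI: "(\<And>x y. x mod n = y mod n \<Longrightarrow> f x = f y) \<Longrightarrow> periodic_mod n f"
  unfolding periodic_mod_def by (meson mod_mod_trivial)

lemma periodic_mod_reflect: "periodic_mod n f \<Longrightarrow> periodic_mod n (\<lambda>x. f (t - x))"
  by (rule periodic_modI, erule periodic_modD) (metis mod_diff_right_eq)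

lemma sum_periodic_shift:
  assumes "n > 0" "periodic_mod n f"
  shows "(\<Sum>x\<in>{0..<n}. f (x + t)) = (\<Sum>x\<in>{0..<n}. f x)"
proof -
  have b: "bij_betw (\<lambda>x. (x + t) mod n) {0..<n} {0..<n}"
    using assms(1) by (intro bij_betw_byWitness[where f' = "\<lambda>y. (y - t) mod n"]) (auto simp: mod_simps)
  have "(\<Sum>x\<in>{0..<n}. f x) = (\<Sum>x\<in>{0..<n}. f ((x + t) mod n))"
    by (rule sum.reindex_bij_betw[OF b, symmetric])
  then show ?thesis
    using assms(2) by (simp add: periodic_mod_def)
qed

lemma sum_periodic_reflect:
  assumes "n > 0" "periodic_mod n f"
  shows "(\<Sum>x\<in>{0..<n}. f (t - x)) = (\<Sum>x\<in>{0..<n}. f x)"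
proof -
  have b: "bij_betw (\<lambda>x. (t - x) mod n) {0..<n} {0..<n}"
    using assms(1) by (intro bij_betw_byWitness[where f' = "\<lambda>y. (t - y) mod n"]) (auto simp: mod_simps)
  have "(\<Sum>x\<in>{0..<n}. f x) = (\<Sum>x\<in>{0..<n}. f ((t - x) mod n))"
    by (rule sum.reindex_bij_betw[OF b, symmetric])
  then show ?thesis
    using assms(2) by (simp add: periodic_mod_def)
qed

lemma mass_nonneg: "(\<And>x. f x \<ge> 0) \<Longrightarrow> mass n f \<ge> 0"
  unfolding mass_def by (simp add: sum_nonneg)

lemma le_mass: "(\<And>x. f x \<ge> 0) \<Longrightarrow> x \<in> {0..<n} \<Longrightarrow> f x \<le> mass n f"
  unfolding mass_def by (rule member_le_sum) auto

lemma mass_shift: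
  assumes "n > 0" "periodic_mod n f"
  shows "mass n (\<lambda>x. f (x + t)) = mass n f"
  using sum_periodic_shift[OF assms] by (simp add: mass_def)

lemma neg_ent_shift:
  assumes "n > 0" "periodic_mod n f"
  shows "neg_ent n (\<lambda>x. f (x + t)) = neg_ent n f"
proof -
  have "periodic_mod n (\<lambda>x. f x * ln (f x / mass n f))"
    using assms(2) by (simp add: periodic_mod_def)
  from sum_periodic_shift[OF assms(1) this] show ?thesis
    by (simp add: neg_ent_def mass_shift[OF assms])
qed

lemma neg_ent_scale:
  assumes "c \<ge> 0"
  shows "neg_ent n (\<lambda>x. c * f x) = c * neg_ent n f"
  by (cases "c = 0") (simp_all add: neg_ent_def mass_def sum_distrib_left[symmetric] mult.assoc)

lemma conv_nonneg: "(\<And>x. f x \<ge> 0) \<Longrightarrow> (\<And>x. g x \<ge> 0) \<Longrightarrow> conv n f g z \<ge> 0"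
  unfolding conv_def by (simp add: sum_nonneg)

lemma conv_commute:
  assumes "n > 0" "periodic_mod n f" "periodic_mod n g"
  shows "conv n f g = conv n g f"
proof
  fix z
  have "periodic_mod n (\<lambda>x. f x * g (z - x))"
    using assms(2) periodic_mod_reflect[OF assms(3), of z] by (simp add: periodic_mod_def)
  from sum_periodic_reflect[OF assms(1) this, of z]
  show "conv n f g z = conv n g f z"
    by (simp add: conv_def mult.commute)
qed

lemma mass_conv:
  assumes "n > 0" "periodic_mod n g"
  shows "mass n (conv n f g) = mass n f * mass n g"
proof -
  have "mass n (conv n f g) = (\<Sum>x\<in>{0..<n}. \<Sum>z\<in>{0..<n}. f x * g (z - x))"
    unfolding mass_def conv_def by (rule sum.swap)
  also have "\<dots> = (\<Sum>x\<in>{0..<n}. f x * mass n g)"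
    using mass_shift[OF assms, of "- _"]
    by (intro sum.cong refl) (simp add: mass_def sum_distrib_left[symmetric])
  finally show ?thesis
    by (simp add: mass_def sum_distrib_right)
qed

section \<open>Log sum inequality and entropy bounds\<close>

text \<open>The right side is convex in \<open>x\<close>, and the left side is its tangent at
  \<open>x = r * X\<close>. Using one \<open>r\<close> for a whole family of pairs and summing gives
  the log sum inequality.\<close>

lemma log_sum_tangent:
  fixes x X r :: real
  assumes "x \<ge> 0" "X \<ge> 0" "r \<ge> 0" "X = 0 \<Longrightarrow> x = 0" "r = 0 \<Longrightarrow> x = 0"
  shows "x * ln r + x - r * X \<le> x * ln (x / X)"
proof (cases "x = 0")
  case True
  then show ?thesis using assms by simp
next
  case False
  then have pos: "x > 0" "X > 0" "r > 0"
    using assms by (metis less_eq_real_def)+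
  have "ln (r * X / x) \<le> r * X / x - 1"
    using pos by (intro ln_le_minus_one) auto
  then have "x * ln (r * X / x) \<le> x * (r * X / x - 1)"
    using pos by (intro mult_left_mono) auto
  then show ?thesis
    using pos by (simp add: ln_div ln_mult algebra_simps)
qed

text \<open>Convexity of negative entropy in unnormalised form: pointwise it is the log sum
  inequality for the pairs (\<open>k i x\<close>, \<open>mass n (k i)\<close>).\<close>

lemma neg_ent_sum_le:
  assumes fin: "finite I" and nn: "\<And>i x. i \<in> I \<Longrightarrow> k i x \<ge> 0"
  shows "neg_ent n (\<lambda>x. \<Sum>i\<in>I. k i x) \<le> (\<Sum>i\<in>I. neg_ent n (k i))"
proof -
  let ?K = "\<lambda>x. \<Sum>i\<in>I. k i x"
  have mK: "mass n ?K = (\<Sum>i\<in>I. mass n (k i))"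
    unfolding mass_def by (rule sum.swap)
  have m0: "mass n (k i) \<ge> 0" if "i \<in> I" for i
    unfolding mass_def using nn[OF that] by (simp add: sum_nonneg)
  have le: "k i x \<le> mass n (k i)" if "i \<in> I" "x \<in> {0..<n}" for i x
    unfolding mass_def using that nn[OF that(1)] by (intro member_le_sum) auto
  have "?K x * ln (?K x / mass n ?K) \<le> (\<Sum>i\<in>I. k i x * ln (k i x / mass n (k i)))"
    if x: "x \<in> {0..<n}" for x
  proof (cases "?K x = 0")
    case True
    then have "\<forall>i\<in>I. k i x = 0"
      using fin nn by (simp add: sum_nonneg_eq_0_iff)
    then show ?thesis by simp
  next
    case False
    moreover have "?K x \<le> mass n ?K"
      unfolding mK using le x by (intro sum_mono) auto
    moreover have "?K x \<ge> 0"
      using nn by (simp add: sum_nonneg)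
    ultimately have pos: "?K x > 0" "mass n ?K > 0" by linarith+
    \<comment> \<open>The ratio of the totals: with it the linear corrections of the tangents cancel
      after summing over \<open>i\<close>.\<close>
    define r where "r = ?K x / mass n ?K"
    have r: "r > 0" using pos by (simp add: r_def)
    have "(\<Sum>i\<in>I. k i x * ln r + k i x - r * mass n (k i)) \<le> (\<Sum>i\<in>I. k i x * ln (k i x / mass n (k i)))"
      using nn m0 r le[OF _ x] by (intro sum_mono log_sum_tangent) (force intro: antisym)+
    moreover have "(\<Sum>i\<in>I. k i x * ln r + k i x - r * mass n (k i)) = ?K x * ln r + ?K x - r * mass n ?K"
      by (simp add: mK sum.distrib sum_subtractf sum_distrib_left sum_distrib_right)
    moreover have "r * mass n ?K = ?K x"
      using pos by (simp add: r_def)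
    ultimately show ?thesis by (simp add: r_def)
  qed
  then have "neg_ent n ?K \<le> (\<Sum>x\<in>{0..<n}. \<Sum>i\<in>I. k i x * ln (k i x / mass n (k i)))"
    unfolding neg_ent_def by (intro sum_mono) auto
  also have "\<dots> = (\<Sum>i\<in>I. neg_ent n (k i))"
    unfolding neg_ent_def by (rule sum.swap)
  finally show ?thesis .
qed

text \<open>Tangents at the ratio \<open>1 / real N\<close>, which belongs to the uniform law on
  \<open>N\<close> points; since \<open>card T \<le> N\<close>, the linear corrections have a
  nonnegative sum.\<close>

lemma neg_ent_ge_support:
  assumes nn: "\<And>x. f x \<ge> 0" and T: "finite T" "card T \<le> N" "N > 0"
    and supp: "\<And>x. x \<in> {0..<n} \<Longrightarrow> f x \<noteq> 0 \<Longrightarrow> x \<in> T"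
  shows "- mass n f * ln (real N) \<le> neg_ent n f"
proof -
  let ?T = "{0..<n} \<inter> T"
  have m: "mass n f = (\<Sum>x\<in>?T. f x)"
    unfolding mass_def using supp by (intro sum.mono_neutral_right) auto
  have e: "neg_ent n f = (\<Sum>x\<in>?T. f x * ln (f x / mass n f))"
    unfolding neg_ent_def using supp by (intro sum.mono_neutral_right) auto
  have "card ?T \<le> N"
    using T by (meson card_mono inf_le2 le_trans)
  then have c: "real (card ?T) \<le> real N" by simp
  have m0: "mass n f \<ge> 0" using nn by (rule mass_nonneg)
  have "(\<Sum>x\<in>?T. f x * ln (1 / real N) + f x - 1 / real N * mass n f) \<le> neg_ent n f"
    unfolding e using T(3) nn le_mass[of f _ n]
    by (intro sum_mono log_sum_tangent m0) (force intro: antisym)+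
  also have "(\<Sum>x\<in>?T. f x * ln (1 / real N) + f x - 1 / real N * mass n f)
      = mass n f * ln (1 / real N) + mass n f - real (card ?T) * (1 / real N * mass n f)"
    by (simp add: sum.distrib sum_subtractf m sum_distrib_right)
  finally have 1: "mass n f * ln (1 / real N) + mass n f - real (card ?T) * (1 / real N * mass n f) \<le> neg_ent n f" .
  have "real (card ?T) * (1 / real N * mass n f) \<le> real N * (1 / real N * mass n f)"
    using m0 c by (intro mult_right_mono) auto
  with 1 T(3) show ?thesis by (simp add: ln_div)
qed

text \<open>A convolution is a superposition of translates of \<open>g\<close> with weights
  \<open>f x\<close>, so convexity applies: adding an independent variable does not decrease
  entropy.\<close>

lemma neg_ent_conv_le:
  assumes "n > 0" "periodic_mod n g" and f: "\<And>x. f x \<ge> 0" and g: "\<And>x. g x \<ge> 0"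
  shows "neg_ent n (conv n f g) \<le> mass n f * neg_ent n g"
proof -
  have "neg_ent n (conv n f g) \<le> (\<Sum>x\<in>{0..<n}. neg_ent n (\<lambda>z. f x * g (z - x)))"
    unfolding conv_def[abs_def] using f g by (intro neg_ent_sum_le) auto
  also have "\<dots> = (\<Sum>x\<in>{0..<n}. f x * neg_ent n g)"
    using neg_ent_shift[OF assms(1,2), of "- _"] f by (simp add: neg_ent_scale)
  finally show ?thesis
    by (simp add: mass_def sum_distrib_right)
qed

lemma sum_split_residues:
  assumes "d > 0" "q > (0::int)"
  shows "(\<Sum>x\<in>{0..<d * q}. F x) = (\<Sum>u\<in>{0..<d}. \<Sum>j\<in>{0..<q}. F (u + d * j))"
proof -
  have range: "u + d * j < d * q" if "u < d" "j < q" for u j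
  proof -
    have "d * (j + 1) \<le> d * q" using that assms by (intro mult_left_mono) auto
    then show ?thesis using that by (simp add: algebra_simps)
  qed
  have "x div d < q" if "0 \<le> x" "x < d * q" for x
    using that assms by (smt (verit) div_pos_geq mult.commute pos_mod_sign minus_mod_eq_mult_div mult_less_cancel_left_pos)
  then have b: "bij_betw (\<lambda>(u, j). u + d * j) ({0..<d} \<times> {0..<q}) {0..<d * q}"
    using assms range
    by (intro bij_betw_byWitness[where f' = "\<lambda>x. (x mod d, x div d)"])
       (auto simp: pos_imp_zdiv_nonneg_iff)
  have "(\<Sum>x\<in>{0..<d * q}. F x) = (\<Sum>(u, j)\<in>{0..<d} \<times> {0..<q}. F (u + d * j))"
    by (subst sum.reindex_bij_betw[OF b, symmetric]) (simp add: case_prod_beta)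
  then show ?thesis by (simp add: sum.cartesian_product)
qed

section \<open>Chain rule along a factorisation of the modulus\<close>

text \<open>The unnormalised law of X conditioned on its residue \<open>u\<close> modulo
  \<open>d\<close>. Any integer may represent the residue: changing \<open>u\<close> by a multiple
  of \<open>d\<close> only translates the fibre.\<close>

definition fibre :: "int \<Rightarrow> (int \<Rightarrow> real) \<Rightarrow> int \<Rightarrow> int \<Rightarrow> real" where
  "fibre d f u j = f (u + d * j)"

definition marginal :: "int \<Rightarrow> int \<Rightarrow> (int \<Rightarrow> real) \<Rightarrow> int \<Rightarrow> real" where
  "marginal d q f u = mass q (fibre d f u)"

text \<open>For probability laws this reads H(X + Y) \<ge> a (H(X) + H(Y)) - K. Both sides are
  homogeneous of degree one in \<open>f\<close> and in \<open>g\<close>, so such bounds can be added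
  over pairs of fibres.\<close>

definition conv_ent_bound :: "int \<Rightarrow> real \<Rightarrow> real \<Rightarrow> (int \<Rightarrow> real) \<Rightarrow> (int \<Rightarrow> real) \<Rightarrow> bool" where
  "conv_ent_bound n a K f g \<longleftrightarrow>
     neg_ent n (conv n f g) \<le> a * (mass n g * neg_ent n f + mass n f * neg_ent n g) + mass n f * mass n g * K"

lemma mass_marginal:
  assumes "d > 0" "q > 0"
  shows "mass d (marginal d q f) = mass (d * q) f"
  unfolding mass_def marginal_def fibre_def using sum_split_residues[OF assms, of f] by simp

text \<open>H(X) = H(X mod d) + H(X | X mod d), obtained by inserting the marginal into the quotient
  under the logarithm.\<close>

lemma neg_ent_chain:
  assumes dq: "d > 0" "q > 0" and nn: "\<And>x. f x \<ge> 0"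
  shows "neg_ent (d * q) f = neg_ent d (marginal d q f) + (\<Sum>u\<in>{0..<d}. neg_ent q (fibre d f u))"
proof -
  let ?F = "mass (d * q) f" and ?m = "marginal d q f"
  have mF: "mass d ?m = ?F" by (rule mass_marginal[OF dq])
  have m0: "?m u \<ge> 0" for u
    unfolding marginal_def by (rule mass_nonneg) (simp add: fibre_def nn)
  have split: "f (u + d * j) * ln (f (u + d * j) / ?F)
      = fibre d f u j * ln (fibre d f u j / ?m u) + fibre d f u j * ln (?m u / ?F)"
    if "u \<in> {0..<d}" "j \<in> {0..<q}" for u j
  proof (cases "f (u + d * j) = 0")
    case True
    then show ?thesis by (simp add: fibre_def)
  next
    case False
    then have f: "f (u + d * j) > 0" using nn by (simp add: less_le)
    have 1: "f (u + d * j) \<le> ?m u"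
      unfolding marginal_def using le_mass[of "fibre d f u" j q] nn that by (simp add: fibre_def)
    have 2: "?m u \<le> ?F"
      using le_mass[of ?m u d] m0 that mF by simp
    show ?thesis
      using f 1 2 by (simp add: fibre_def ln_div algebra_simps)
  qed
  have "neg_ent (d * q) f = (\<Sum>u\<in>{0..<d}. \<Sum>j\<in>{0..<q}. f (u + d * j) * ln (f (u + d * j) / ?F))"
    unfolding neg_ent_def by (rule sum_split_residues[OF dq])
  also have "\<dots> = (\<Sum>u\<in>{0..<d}. \<Sum>j\<in>{0..<q}. fibre d f u j * ln (fibre d f u j / ?m u) + fibre d f u j * ln (?m u / ?F))"
    by (intro sum.cong refl split)
  also have "\<dots> = (\<Sum>u\<in>{0..<d}. neg_ent q (fibre d f u) + ?m u * ln (?m u / ?F))"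
    by (simp add: sum.distrib neg_ent_def marginal_def mass_def sum_distrib_right)
  finally show ?thesis
    by (simp add: sum.distrib neg_ent_def[of d] mF)
qed

lemma periodic_mod_fibre:
  assumes "periodic_mod (d * q) f"
  shows "periodic_mod q (fibre d f u)"
  unfolding periodic_mod_def fibre_def
proof
  fix j
  have "(u + d * (j mod q)) mod (d * q) = (u + d * j) mod (d * q)"
    by (metis mod_add_right_eq mod_mod_trivial mult_mod_right)
  then show "f (u + d * (j mod q)) = f (u + d * j)"
    by (rule periodic_modD[OF assms])
qed

lemma fibre_cong_shift:
  assumes "x mod d = y mod d"
  shows "\<exists>t. fibre d f x = (\<lambda>j. fibre d f y (j + t))"
proof -
  obtain t where "x = y + d * t"
    using assms by (metis mod_eqE)
  then show ?thesis
    by (intro exI[of _ t]) (auto simp: fibre_def algebra_simps)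
qed

lemma periodic_mod_marginal:
  assumes "q > 0" "periodic_mod (d * q) f"
  shows "periodic_mod d (marginal d q f)"
proof (rule periodic_modI)
  fix x y assume "x mod d = y mod d"
  then obtain t where "fibre d f x = (\<lambda>j. fibre d f y (j + t))"
    using fibre_cong_shift by blast
  then show "marginal d q f x = marginal d q f y"
    unfolding marginal_def by (simp add: mass_shift[OF assms(1) periodic_mod_fibre[OF assms(2)]])
qed

lemma periodic_mod_neg_ent_fibre:
  assumes "q > 0" "periodic_mod (d * q) f"
  shows "periodic_mod d (\<lambda>u. neg_ent q (fibre d f u))"
proof (rule periodic_modI)
  fix x y assume "x mod d = y mod d"
  then obtain t where "fibre d f x = (\<lambda>j. fibre d f y (j + t))"
    using fibre_cong_shift by blast
  then show "neg_ent q (fibre d f x) = neg_ent q (fibre d f y)"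
    by (simp add: neg_ent_shift[OF assms(1) periodic_mod_fibre[OF assms(2)]])
qed

text \<open>A sum lies in the class \<open>w\<close> exactly when its terms lie in classes
  \<open>u\<close> and \<open>w - u\<close>. Leaving \<open>w - u\<close> unreduced modulo
  \<open>d\<close> avoids carries.\<close>

lemma fibre_conv:
  assumes "d > 0" "q > 0"
  shows "fibre d (conv (d * q) f g) w = (\<lambda>k. \<Sum>u\<in>{0..<d}. conv q (fibre d f u) (fibre d g (w - u)) k)"
  by (rule ext) (simp add: fibre_def conv_def sum_split_residues[OF assms] algebra_simps)

lemma marginal_conv:
  assumes "d > 0" "q > 0" "periodic_mod (d * q) g"
  shows "marginal d q (conv (d * q) f g) = conv d (marginal d q f) (marginal d q g)"
proof
  fix w
  have "marginal d q (conv (d * q) f g) w = (\<Sum>u\<in>{0..<d}. mass q (conv q (fibre d f u) (fibre d g (w - u))))"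
    unfolding marginal_def fibre_conv[OF assms(1,2)] unfolding mass_def by (rule sum.swap)
  also have "\<dots> = conv d (marginal d q f) (marginal d q g) w"
    by (simp add: conv_def[of d] marginal_def mass_conv[OF assms(2) periodic_mod_fibre[OF assms(3)]])
  finally show "marginal d q (conv (d * q) f g) w = conv d (marginal d q f) (marginal d q g) w" .
qed

text \<open>By the chain rule the entropy of X + Y splits into a part modulo \<open>d\<close>,
  governed by \<open>base\<close>, and the fibres over \<open>w\<close>. Each such fibre is a
  superposition of convolutions of fibres, so convexity reduces it to \<open>fib\<close>.\<close>

lemma conv_ent_bound_extend:
  assumes dq: "d > 0" "q > 0" and per: "periodic_mod (d * q) f" "periodic_mod (d * q) g"
    and f: "\<And>x. f x \<ge> 0" and g: "\<And>x. g x \<ge> 0"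
    and base: "conv_ent_bound d a K (marginal d q f) (marginal d q g)"
    and fib: "\<And>u v. conv_ent_bound q a k (fibre d f u) (fibre d g v)"
  shows "conv_ent_bound (d * q) a (K + k) f g"
proof -
  let ?F = "mass (d * q) f" and ?G = "mass (d * q) g"
  let ?m = "marginal d q"
  let ?e = "\<lambda>f u. neg_ent q (fibre d f u)"
  let ?D = "{0..<d}"
  have mF: "mass d (?m f) = ?F" "mass d (?m g) = ?G"
    by (rule mass_marginal[OF dq])+
  have fn: "fibre d f u j \<ge> 0" "fibre d g u j \<ge> 0" for u j
    using f g by (simp_all add: fibre_def)
  have sf: "(\<Sum>u\<in>?D. ?m f u) = ?F"
    using mF(1) by (simp add: mass_def)
  have sg: "(\<Sum>w\<in>?D. ?m g (w - u)) = ?G" for u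
    using mass_shift[OF dq(1) periodic_mod_marginal[OF dq(2) per(2)], of "- u"] mF by (simp add: mass_def)
  have se: "(\<Sum>w\<in>?D. ?e g (w - u)) = (\<Sum>v\<in>?D. ?e g v)" for u
    using sum_periodic_shift[OF dq(1) periodic_mod_neg_ent_fibre[OF dq(2) per(2)], of "- u"] by simp
  have "(\<Sum>w\<in>?D. ?e (conv (d * q) f g) w)
      \<le> (\<Sum>w\<in>?D. \<Sum>u\<in>?D. neg_ent q (conv q (fibre d f u) (fibre d g (w - u))))"
    unfolding fibre_conv[OF dq] using fn by (intro sum_mono neg_ent_sum_le conv_nonneg) auto
  also have "\<dots> \<le> (\<Sum>w\<in>?D. \<Sum>u\<in>?D. a * (?m g (w - u) * ?e f u + ?m f u * ?e g (w - u)) + ?m f u * ?m g (w - u) * k)"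
    using fib by (intro sum_mono) (simp add: conv_ent_bound_def marginal_def)
  \<comment> \<open>For fixed \<open>u\<close> the class \<open>w - u\<close> runs through all
    residues, so the terms belonging to \<open>g\<close> add up to totals independent of
    \<open>u\<close>.\<close>
  also have "\<dots> = (\<Sum>u\<in>?D. \<Sum>w\<in>?D. a * (?m g (w - u) * ?e f u + ?m f u * ?e g (w - u)) + ?m f u * ?m g (w - u) * k)"
    by (rule sum.swap)
  also have "\<dots> = (\<Sum>u\<in>?D. a * (?G * ?e f u + ?m f u * (\<Sum>v\<in>?D. ?e g v)) + ?m f u * ?G * k)"
    by (simp add: sum.distrib sum_distrib_left[symmetric] sum_distrib_right[symmetric] sg se)
  also have "\<dots> = a * (?G * (\<Sum>u\<in>?D. ?e f u) + ?F * (\<Sum>v\<in>?D. ?e g v)) + ?F * ?G * k"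
    by (simp add: sum.distrib sum_distrib_left[symmetric] sum_distrib_right[symmetric] sf)
  finally have 1: "(\<Sum>w\<in>?D. ?e (conv (d * q) f g) w)
      \<le> a * (?G * (\<Sum>u\<in>?D. ?e f u) + ?F * (\<Sum>v\<in>?D. ?e g v)) + ?F * ?G * k" .
  have 2: "neg_ent d (?m (conv (d * q) f g)) \<le> a * (?G * neg_ent d (?m f) + ?F * neg_ent d (?m g)) + ?F * ?G * K"
    using base by (simp add: conv_ent_bound_def marginal_conv[OF dq per(2)] mF)
  have 3: "neg_ent (d * q) (conv (d * q) f g) = neg_ent d (?m (conv (d * q) f g)) + (\<Sum>w\<in>?D. ?e (conv (d * q) f g) w)"
    using f g by (intro neg_ent_chain dq conv_nonneg)
  show ?thesis
    unfolding conv_ent_bound_def 3 neg_ent_chain[OF dq f] neg_ent_chain[OF dq g]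
    using add_mono[OF 1 2] by (simp add: algebra_simps)
qed

section \<open>Trivial bound and induction over the prime factors of the modulus\<close>

text \<open>The average of H(X + Y) \<ge> H(X) and H(X + Y) \<ge> H(Y) settles the coefficient 1/2;
  the excess \<open>a - 1 / 2\<close> is paid for by the upper bound \<open>l\<close> on both
  entropies.\<close>

lemma conv_ent_bound_trivial:
  assumes "n > 0" "a \<ge> 1 / 2" and per: "periodic_mod n f" "periodic_mod n g"
    and f: "\<And>x. f x \<ge> 0" and g: "\<And>x. g x \<ge> 0"
    and lf: "- mass n f * l \<le> neg_ent n f" and lg: "- mass n g * l \<le> neg_ent n g"
  shows "conv_ent_bound n a ((2 * a - 1) * l) f g"
proof -
  have 1: "neg_ent n (conv n f g) \<le> mass n f * neg_ent n g"
    by (rule neg_ent_conv_le) (use assms in auto)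
  have 2: "neg_ent n (conv n f g) \<le> mass n g * neg_ent n f"
    unfolding conv_commute[OF assms(1) per] by (rule neg_ent_conv_le) (use assms in auto)
  have "mass n g * (- mass n f * l) \<le> mass n g * neg_ent n f" "mass n f * (- mass n g * l) \<le> mass n f * neg_ent n g"
    using mass_nonneg[of f n, OF f] mass_nonneg[of g n, OF g] lf lg by (blast intro: mult_left_mono)+
  then have "0 \<le> (a - 1 / 2) * (mass n g * neg_ent n f + mass n f * neg_ent n g + 2 * mass n f * mass n g * l)"
    using assms(2) by (intro mult_nonneg_nonneg) (auto simp: algebra_simps)
  with 1 2 show ?thesis
    unfolding conv_ent_bound_def by (simp add: algebra_simps)
qed

lemma neg_ent_ge_modulus:
  assumes "\<And>x. f x \<ge> 0" "n > 0"
  shows "- mass n f * ln (real_of_int n) \<le> neg_ent n f"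
  using neg_ent_ge_support[of f "{0..<n}" "nat n" n] assms by simp

lemma neg_ent_ge_avoid:
  assumes nn: "\<And>x. f x \<ge> 0" and n: "n > 1" and per: "periodic_mod n f" and "f t = 0"
  shows "- mass n f * ln (real_of_int n - 1) \<le> neg_ent n f"
proof -
  have "f (t mod n) = 0"
    using assms(4) per by (simp add: periodic_mod_def)
  then have "- mass n f * ln (real (nat (n - 1))) \<le> neg_ent n f"
    using n by (intro neg_ent_ge_support[of f "{0..<n} - {t mod n}"] nn) auto
  then show ?thesis using n by simp
qed

text \<open>The logarithms in the constant encode D'(X + Y) \<le> a (D(X) + D(Y)) + \<Sum> c(p). The
  induction splits off one prime, \<open>m = d * p\<close>, taking marginals modulo \<open>d\<close>
  and fibres modulo \<open>p\<close>.\<close>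

lemma conv_ent_bound_coprime:
  fixes c :: "nat \<Rightarrow> real"
  assumes a: "a \<ge> 1 / 2"
    and prime_bound: "\<And>p f g. prime p \<Longrightarrow> periodic_mod (int p) f \<Longrightarrow> periodic_mod (int p) g \<Longrightarrow>
        (\<And>x. f x \<ge> 0) \<Longrightarrow> (\<And>x. g x \<ge> 0) \<Longrightarrow> (\<exists>x. f x = 0) \<Longrightarrow> (\<exists>x. g x = 0) \<Longrightarrow>
        conv_ent_bound (int p) a (2 * a * ln (real p - 1) - ln (real p) + c p) f g"
  shows "m > 0 \<Longrightarrow> periodic_mod (int m) f \<Longrightarrow> periodic_mod (int m) g \<Longrightarrow>
        (\<And>x. f x \<ge> 0) \<Longrightarrow> (\<And>x. g x \<ge> 0) \<Longrightarrow>
        (\<And>x. \<not> coprime x (int m) \<Longrightarrow> f x = 0) \<Longrightarrow> (\<And>x. \<not> coprime x (int m) \<Longrightarrow> g x = 0) \<Longrightarrow>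
        conv_ent_bound (int m) a (2 * a * ln (real (totient m)) - ln (real m) + (\<Sum>p\<in>prime_factors m. c p)) f g"
proof (induction m arbitrary: f g rule: less_induct)
  case (less m)
  show ?case
  proof (cases "m = 1")
    case True
    have "{0..<1::int} = {0}" by auto
    then show ?thesis
      using True by (simp add: conv_ent_bound_def neg_ent_def mass_def)
  next
    case False
    then obtain p where p: "prime p" "p dvd m"
      using prime_factor_nat by blast
    then obtain d where m: "m = d * p" by (metis dvd_def mult.commute)
    have d: "d > 0" "p > 0" "p > 1" "d < m"
      using m less.prems(1) p(1) prime_gt_1_nat[OF p(1)] by (auto intro: Nat.gr0I)
    have im: "int m = int d * int p" using m by simp
    have per: "periodic_mod (int d * int p) f" "periodic_mod (int d * int p) g"
      using less.prems(2,3) im by auto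
    have vanish: "marginal (int d) (int p) h x = 0"
      if h: "\<And>x. \<not> coprime x (int m) \<Longrightarrow> h x = 0" and x: "\<not> coprime x (int d)" for h x
    proof -
      have "\<not> coprime (x + int d * j) (int m)" for j
      proof
        assume "coprime (x + int d * j) (int m)"
        then have "coprime (x + int d * j) (int d)" by (simp add: im)
        then have "coprime x (int d)"
          by (metis coprime_iff_gcd_eq_1 gcd.commute gcd_add_mult mult.commute add.commute)
        with x show False ..
      qed
      then show ?thesis
        using h by (simp add: marginal_def mass_def fibre_def)
    qed
    have base: "conv_ent_bound (int d) a (2 * a * ln (real (totient d)) - ln (real d) + (\<Sum>p\<in>prime_factors d. c p))
        (marginal (int d) (int p) f) (marginal (int d) (int p) g)"
      using d less.prems per
      by (intro less.IH vanish periodic_mod_marginal) (auto simp: marginal_def fibre_def intro!: mass_nonneg)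
    have fper: "periodic_mod (int p) (fibre (int d) f u)" "periodic_mod (int p) (fibre (int d) g u)" for u
      using per by (auto intro: periodic_mod_fibre)
    have fnn: "fibre (int d) f u x \<ge> 0" "fibre (int d) g u x \<ge> 0" for u x
      using less.prems by (auto simp: fibre_def)
    show ?thesis
    proof (cases "p dvd d")
      case True
      \<comment> \<open>Here \<phi> and the modulus both grow by the factor \<open>p\<close>, so the
        constant may grow by exactly \<open>(2 * a - 1) * ln (real p)\<close>, which is what the
        trivial bound gives. A repeated prime costs nothing.\<close>
      have "conv_ent_bound (int p) a ((2 * a - 1) * ln (real p)) (fibre (int d) f u) (fibre (int d) g v)" for u v
        using d a fper fnn neg_ent_ge_modulus[of "fibre (int d) f u" "int p"] neg_ent_ge_modulus[of "fibre (int d) g v" "int p"]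
        by (intro conv_ent_bound_trivial) auto
      from conv_ent_bound_extend[OF _ _ per less.prems(4,5) base this] d
      have 1: "conv_ent_bound (int m) a (2 * a * ln (real (totient d)) - ln (real d) + (\<Sum>p\<in>prime_factors d. c p)
          + (2 * a - 1) * ln (real p)) f g"
        by (simp add: im)
      have "totient m = totient d * p"
        using totient_gcd[of d p] True d m by (simp add: gcd_nat.absorb2)
      moreover have "prime_factors m = prime_factors d"
        using m d p True by (auto simp: prime_factors_dvd prime_dvd_mult_iff intro: dvd_trans)
      ultimately show ?thesis
        using 1 d m by (simp add: ln_mult algebra_simps)
    next
      case False
      then have cop: "coprime d p"
        using p(1) by (metis coprime_commute prime_imp_coprime)
      \<comment> \<open>Since \<open>d\<close> is invertible modulo \<open>p\<close>, each class
        modulo \<open>d\<close> contains a multiple of \<open>p\<close>, where \<open>h\<close>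
        vanishes.\<close>
      have zero: "\<exists>j. fibre (int d) h u j = 0"
        if h: "\<And>x. \<not> coprime x (int m) \<Longrightarrow> h x = 0" for h u
      proof -
        obtain y where "[int d * y = - u] (mod int p)"
          using cong_solve_coprime_int[of "int d" "int p"] cop
          by (metis coprime_int_iff cong_scalar_right mult.assoc mult.left_neutral)
        then have "int p dvd u + int d * y"
          by (metis cong_iff_dvd_diff diff_minus_eq_add add.commute)
        moreover have "int p dvd int m" using p(2) by simp
        moreover have "\<not> is_unit (int p)" using d(3) by simp
        ultimately have "\<not> coprime (u + int d * y) (int m)"
          using not_coprimeI by blast
        then show ?thesis using h by (auto simp: fibre_def)
      qed
      have "conv_ent_bound (int p) a (2 * a * ln (real p - 1) - ln (real p) + c p) (fibre (int d) f u) (fibre (int d) g v)" for u v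
        using less.prems by (intro prime_bound p fper fnn zero) auto
      from conv_ent_bound_extend[OF _ _ per less.prems(4,5) base this] d
      have 1: "conv_ent_bound (int m) a (2 * a * ln (real (totient d)) - ln (real d) + (\<Sum>p\<in>prime_factors d. c p)
          + (2 * a * ln (real p - 1) - ln (real p) + c p)) f g"
        by (simp add: im)
      have "totient m = totient d * (p - 1)"
        using cop m p(1) by (simp add: totient_mult_coprime totient_prime)
      then have "ln (real (totient m)) = ln (real (totient d)) + ln (real p - 1)"
        using d by (simp add: ln_mult of_nat_diff)
      moreover have "prime_factors m = insert p (prime_factors d)" "p \<notin> prime_factors d"
        using m d p False by (auto simp: prime_factors_product prime_prime_factors)
      ultimately show ?thesis
        using 1 d m by (simp add: ln_mult algebra_simps)
    qed
  qed
qed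

section \<open>Convolution of nearly uniform densities\<close>

text \<open>The integrand of relative entropy with respect to the uniform law, normalised to be
  nonnegative with its zero at 1; the added linear terms cancel when a density of mean 1 is
  summed.\<close>

definition rel_ent :: "real \<Rightarrow> real" where
  "rel_ent z = z * ln z - z + 1"

text \<open>Pointwise comparison of Hellinger distance and relative entropy: with
  \<open>s = sqrt z\<close> it is \<open>ln (1 / s) \<le> 1 / s - 1\<close> multiplied by
  \<open>2 * s\<^sup>2\<close>.\<close>

lemma hellinger_le_rel_ent:
  assumes "z \<ge> 0"
  shows "(sqrt z - 1)\<^sup>2 \<le> rel_ent z"
proof (cases "z = 0")
  case True
  then show ?thesis by (simp add: rel_ent_def)
next
  case False
  define s where "s = sqrt z"
  have s: "s > 0" "z = s\<^sup>2" using assms False by (auto simp: s_def)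
  have "ln (1 / s) \<le> 1 / s - 1"
    using s by (intro ln_le_minus_one) simp
  then have "s\<^sup>2 * ln (1 / s) \<le> s\<^sup>2 * (1 / s - 1)"
    by (intro mult_left_mono) auto
  then have "s\<^sup>2 * ln s \<ge> s\<^sup>2 - s"
    using s(1) by (simp add: ln_div power2_eq_square algebra_simps)
  moreover have "ln z = 2 * ln s" using s by (simp add: ln_realpow)
  ultimately show ?thesis
    unfolding rel_ent_def s_def[symmetric] using s(2) by (simp add: power2_eq_square algebra_simps)
qed

lemma rel_ent_nonneg: "z \<ge> 0 \<Longrightarrow> rel_ent z \<ge> 0"
  using hellinger_le_rel_ent[of z] by (meson order_trans zero_le_power2)

text \<open>Densities are cut at 2: \<open>rel_ent\<close> controls the bounded part in mean square,
  and \<open>excess_le_rel_ent\<close> controls the rest in mean.\<close>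

lemma truncated_square_le_rel_ent:
  assumes "z \<ge> 0"
  shows "(min z 2 - 1)\<^sup>2 \<le> 6 * rel_ent z"
proof -
  define s where "s = sqrt z"
  have s: "s \<ge> 0" "z = s\<^sup>2" using assms by (auto simp: s_def)
  have h: "(s - 1)\<^sup>2 \<le> rel_ent z"
    using hellinger_le_rel_ent[OF assms] by (simp add: s_def)
  show ?thesis
  proof (cases "z \<le> 2")
    case True
    \<comment> \<open>A rational bound for the root of 2 that is sharp enough for 2.42^2 <
      6.\<close>
    have "s \<le> 1.42"
    proof (rule ccontr)
      assume "\<not> s \<le> 1.42"
      then have "1.42 * 1.42 \<le> s * s" by (intro mult_mono) auto
      with True s show False by (simp add: power2_eq_square)
    qed
    then have "(s + 1) * (s + 1) \<le> 2.42 * 2.42"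
      using s by (intro mult_mono) auto
    then have "(s + 1)\<^sup>2 * (s - 1)\<^sup>2 \<le> 6 * (s - 1)\<^sup>2"
      by (intro mult_right_mono) (auto simp: power2_eq_square)
    moreover have "(min z 2 - 1)\<^sup>2 = (s + 1)\<^sup>2 * (s - 1)\<^sup>2"
      using True s(2) by (simp add: power2_eq_square algebra_simps)
    ultimately show ?thesis using h by linarith
  next
    case False
    \<comment> \<open>Similarly, 6 * 0.41^2 > 1.\<close>
    have "s \<ge> 1.41"
    proof (rule ccontr)
      assume "\<not> s \<ge> 1.41"
      then have "s * s \<le> 1.41 * 1.41" using s by (intro mult_mono) auto
      with False s show False by (simp add: power2_eq_square)
    qed
    then have "0.41 * 0.41 \<le> (s - 1) * (s - 1)" by (intro mult_mono) auto
    then have "1 \<le> 6 * (s - 1)\<^sup>2" by (simp add: power2_eq_square)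
    with h False show ?thesis by simp
  qed
qed

lemma excess_le_rel_ent:
  assumes "z \<ge> 0"
  shows "max (z - 2) 0 \<le> 6 * rel_ent z"
proof -
  define s where "s = sqrt z"
  have s: "s \<ge> 0" "z = s\<^sup>2" using assms by (auto simp: s_def)
  \<comment> \<open>The completed square of 6 (s - 1)^2 - (s^2 - 2).\<close>
  have "0 \<le> 5 * (s - 6 / 5)\<^sup>2 + 4 / 5" by simp
  then have "z - 2 \<le> 6 * (s - 1)\<^sup>2"
    unfolding s(2) by (simp add: power2_eq_square algebra_simps)
  with hellinger_le_rel_ent[OF assms] rel_ent_nonneg[OF assms] show ?thesis by (simp add: s_def)
qed

text \<open>By convexity the large part Q of a density costs only Q ln (1 + w + Q), while the small part w
  enters quadratically.\<close>

lemma rel_ent_perturb: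
  fixes w Q :: real
  assumes "w > - 1" "Q \<ge> 0"
  shows "rel_ent (1 + w + Q) \<le> w\<^sup>2 + Q * ln (1 + w + Q)"
proof -
  have e: "1 + w + Q = (1 + w) * (1 + Q / (1 + w))"
    using assms by (simp add: field_simps)
  have 1: "ln (1 + w) \<le> w"
    using assms ln_le_minus_one[of "1 + w"] by simp
  have q0: "Q / (1 + w) \<ge> 0"
    using assms by (intro divide_nonneg_pos) auto
  then have 2: "ln (1 + Q / (1 + w)) \<le> Q / (1 + w)"
    by (rule ln_add_one_self_le_self)
  have "ln (1 + w + Q) = ln (1 + w) + ln (1 + Q / (1 + w))"
    unfolding e using assms q0 by (intro ln_mult_pos) linarith+
  with 1 2 have "ln (1 + w + Q) \<le> w + Q / (1 + w)" by linarith
  then have "(1 + w) * ln (1 + w + Q) \<le> (1 + w) * (w + Q / (1 + w))"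
    using assms by (intro mult_left_mono) auto
  also have "\<dots> = (1 + w) * w + Q"
    using assms by (simp add: field_simps)
  finally show ?thesis
    unfolding rel_ent_def by (simp add: power2_eq_square algebra_simps)
qed

text \<open>The uniformly small part \<open>w\<close> of the convolution enters
  \<open>rel_ent_perturb\<close> squared, giving 324 = 18^2; the part \<open>Q\<close> of mean at
  most 36 \<delta>^2 costs a factor \<open>ln n\<close>. The condition on \<delta> keeps
  \<open>w\<close> above -1.\<close>

lemma sum_rel_ent_conv_le:
  fixes u v :: "int \<Rightarrow> real"
  assumes n: "n > 0" and per: "periodic_mod n u" "periodic_mod n v"
    and nn: "\<And>x. u x \<ge> 0" "\<And>x. v x \<ge> 0"
    and mass: "mass n u = of_int n" "mass n v = of_int n"
    and ent: "(\<Sum>x\<in>{0..<n}. rel_ent (u x)) \<le> of_int n * \<delta>" "(\<Sum>x\<in>{0..<n}. rel_ent (v x)) \<le> of_int n * \<delta>"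
    and \<delta>: "18 * \<delta> < 1"
  shows "(\<Sum>z\<in>{0..<n}. rel_ent (conv n u v z / of_int n)) \<le> of_int n * (\<delta>\<^sup>2 * (324 + 36 * ln (of_int n)))"
proof -
  define N where "N = real_of_int n"
  have N: "N \<ge> 1" using n by (simp add: N_def)
  let ?I = "{0..<n}"
  define s r where "s = (\<lambda>z::real. min z 2 - 1)" and "r = (\<lambda>z::real. max (z - 2) 0)"
  have dec: "z = 1 + s z + r z" for z by (simp add: s_def r_def)
  have r0: "r z \<ge> 0" for z by (simp add: r_def)
  have s1: "\<bar>s z\<bar> \<le> 1" if "z \<ge> 0" for z using that by (simp add: s_def)
  have S: "(\<Sum>x\<in>?I. (s (f x))\<^sup>2) \<le> 6 * (N * \<delta>)" and R: "(\<Sum>x\<in>?I. r (f x)) \<le> 6 * (N * \<delta>)"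
    if "\<And>x. f x \<ge> 0" "(\<Sum>x\<in>?I. rel_ent (f x)) \<le> N * \<delta>" for f
  proof -
    have "(\<Sum>x\<in>?I. (s (f x))\<^sup>2) \<le> (\<Sum>x\<in>?I. 6 * rel_ent (f x))"
      using that(1) truncated_square_le_rel_ent by (intro sum_mono) (simp add: s_def)
    moreover have "(\<Sum>x\<in>?I. r (f x)) \<le> (\<Sum>x\<in>?I. 6 * rel_ent (f x))"
      using that(1) excess_le_rel_ent by (intro sum_mono) (simp add: r_def)
    ultimately show "(\<Sum>x\<in>?I. (s (f x))\<^sup>2) \<le> 6 * (N * \<delta>)" "(\<Sum>x\<in>?I. r (f x)) \<le> 6 * (N * \<delta>)"
      using that(2) by (simp_all add: sum_distrib_left[symmetric])
  qed
  have Su: "(\<Sum>x\<in>?I. (s (u x))\<^sup>2) \<le> 6 * (N * \<delta>)" "(\<Sum>x\<in>?I. r (u x)) \<le> 6 * (N * \<delta>)"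
    and Sv: "(\<Sum>x\<in>?I. (s (v x))\<^sup>2) \<le> 6 * (N * \<delta>)" "(\<Sum>x\<in>?I. r (v x)) \<le> 6 * (N * \<delta>)"
    using S R nn ent by (simp_all add: N_def)
  have vrefl: "(\<Sum>x\<in>?I. h (v (z - x))) = (\<Sum>x\<in>?I. h (v x))" for h :: "real \<Rightarrow> real" and z
    using sum_periodic_reflect[OF n, of "\<lambda>x. h (v x)" z] per(2) by (simp add: periodic_mod_def)
  have "0 \<le> (\<Sum>x\<in>?I. rel_ent (u x))"
    using nn by (intro sum_nonneg rel_ent_nonneg)
  then have N\<delta>: "0 \<le> N * \<delta>"
    using ent(1) by (simp add: N_def)
  \<comment> \<open>In (u - 1) * (v - 1) = (s + r) * (s' + r') all terms except r * r' are uniformly O(\<delta>), and the mean of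
      r * r' is O(\<delta>^2).\<close>
  define Q where "Q = (\<lambda>z. (\<Sum>x\<in>?I. r (u x) * r (v (z - x))) / N)"
  define w where "w = (\<lambda>z. conv n u v z / N - 1 - Q z)"
  have Q0: "Q z \<ge> 0" for z
    unfolding Q_def using r0 N by (intro divide_nonneg_nonneg sum_nonneg mult_nonneg_nonneg) auto
  have sumQ: "(\<Sum>z\<in>?I. Q z) \<le> N * (36 * \<delta>\<^sup>2)"
  proof -
    have p: "periodic_mod n (\<lambda>x. r (v x))" using per(2) by (simp add: periodic_mod_def)
    have "(\<Sum>z\<in>?I. Q z) = mass n (conv n (\<lambda>x. r (u x)) (\<lambda>x. r (v x))) / N"
      by (simp add: Q_def mass_def conv_def sum_divide_distrib)
    also have "\<dots> = (\<Sum>x\<in>?I. r (u x)) * (\<Sum>x\<in>?I. r (v x)) / N"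
      by (simp add: mass_conv[OF n p]) (simp add: mass_def)
    also have "\<dots> \<le> (6 * (N * \<delta>)) * (6 * (N * \<delta>)) / N"
      using Su Sv N r0 N\<delta> by (intro divide_right_mono mult_mono) (auto intro: sum_nonneg)
    also have "\<dots> = N * (36 * \<delta>\<^sup>2)"
      using N by (simp add: power2_eq_square)
    finally show ?thesis .
  qed
  have w: "\<bar>w z\<bar> \<le> 18 * \<delta>" for z
  proof -
    let ?v = "\<lambda>x. v (z - x)"
    have NwQ: "N * w z = conv n u v z - N - (\<Sum>x\<in>?I. r (u x) * r (?v x))"
      using N by (simp add: w_def Q_def right_diff_distrib)
    \<comment> \<open>The source of the quadratic gain: \<open>u - 1\<close> and
      \<open>v - 1\<close> have mean 0, so the linear terms vanish.\<close>
    have "conv n u v z - N = (\<Sum>x\<in>?I. (u x - 1) * (?v x - 1))"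
    proof -
      have "(\<Sum>x\<in>?I. (u x - 1) * (?v x - 1)) = (\<Sum>x\<in>?I. u x * ?v x - u x - ?v x + 1)"
        by (intro sum.cong refl) (simp add: algebra_simps)
      also have "\<dots> = conv n u v z - mass n u - (\<Sum>x\<in>?I. ?v x) + N"
        using n by (simp add: sum.distrib sum_subtractf conv_def mass_def N_def)
      also have "(\<Sum>x\<in>?I. ?v x) = mass n v"
        using vrefl[of "\<lambda>x. x" z] by (simp add: mass_def)
      finally show ?thesis using mass by (simp add: N_def)
    qed
    also have "\<dots> = (\<Sum>x\<in>?I. s (u x) * s (?v x) + s (u x) * r (?v x) + r (u x) * s (?v x) + r (u x) * r (?v x))"
    proof (intro sum.cong refl)
      fix x
      have "u x - 1 = s (u x) + r (u x)" "?v x - 1 = s (?v x) + r (?v x)"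
        using dec[of "u x"] dec[of "?v x"] by linarith+
      then show "(u x - 1) * (?v x - 1) = s (u x) * s (?v x) + s (u x) * r (?v x) + r (u x) * s (?v x) + r (u x) * r (?v x)"
        by (simp only: distrib_left distrib_right add.assoc add.left_commute)
    qed
    finally have "N * w z = (\<Sum>x\<in>?I. s (u x) * s (?v x) + s (u x) * r (?v x) + r (u x) * s (?v x))"
      using NwQ by (simp add: sum.distrib)
    \<comment> \<open>Arithmetic-geometric mean for \<open>s * s\<close>, and the bound 1 on
      \<open>\<bar>s\<bar>\<close> for the mixed terms. The total is (6 + 6) / 2 + 6 + 6 =
      18.\<close>
    also have "\<bar>\<dots>\<bar> \<le> (\<Sum>x\<in>?I. ((s (u x))\<^sup>2 + (s (?v x))\<^sup>2) / 2 + r (?v x) + r (u x))"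
    proof (rule order_trans[OF sum_abs], rule sum_mono)
      fix x
      have "\<bar>s (u x) * s (?v x)\<bar> \<le> ((s (u x))\<^sup>2 + (s (?v x))\<^sup>2) / 2"
        using zero_le_power2[of "\<bar>s (u x)\<bar> - \<bar>s (?v x)\<bar>"] by (simp add: abs_mult power2_diff)
      moreover have "\<bar>s (u x) * r (?v x)\<bar> \<le> r (?v x)" "\<bar>r (u x) * s (?v x)\<bar> \<le> r (u x)"
        using s1[OF nn(1)] s1[OF nn(2)] r0 by (auto simp: abs_mult intro: mult_left_le mult_left_le_one_le)
      ultimately show "\<bar>s (u x) * s (?v x) + s (u x) * r (?v x) + r (u x) * s (?v x)\<bar>
          \<le> ((s (u x))\<^sup>2 + (s (?v x))\<^sup>2) / 2 + r (?v x) + r (u x)" by linarith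
    qed
    also have "\<dots> = ((\<Sum>x\<in>?I. (s (u x))\<^sup>2) + (\<Sum>x\<in>?I. (s (?v x))\<^sup>2)) / 2 + (\<Sum>x\<in>?I. r (?v x)) + (\<Sum>x\<in>?I. r (u x))"
      by (simp add: sum.distrib sum_divide_distrib[symmetric])
    also have "\<dots> \<le> N * (18 * \<delta>)"
      using Su Sv by (simp add: vrefl[of "\<lambda>x. (s x)\<^sup>2" z] vrefl[of r z] field_simps)
    finally show ?thesis using N by (simp add: abs_mult)
  qed
  have "rel_ent (conv n u v z / N) \<le> (18 * \<delta>)\<^sup>2 + Q z * ln N" if "z \<in> ?I" for z
  proof -
    have eq: "conv n u v z / N = 1 + w z + Q z" by (simp add: w_def)
    have pos: "w z > -1" using w[of z] \<delta> by linarith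
    \<comment> \<open>The crude bound \<open>N\<close> on the density suffices, since it enters only
      through a logarithm.\<close>
    have vN: "v x \<le> N" for x
    proof -
      have "v (x mod n) \<le> mass n v" using n nn by (intro le_mass) auto
      then show ?thesis using per(2) mass by (simp add: periodic_mod_def N_def)
    qed
    have "conv n u v z \<le> (\<Sum>x\<in>?I. u x * N)"
      unfolding conv_def using nn vN by (intro sum_mono mult_left_mono) auto
    also have "\<dots> = N * N"
      using mass(1) by (simp add: sum_distrib_right[symmetric] mass_def N_def)
    finally have "1 + w z + Q z \<le> N"
      unfolding eq[symmetric] using N by (simp add: field_simps)
    then have "ln (1 + w z + Q z) \<le> ln N"
      using pos Q0[of z] by simp
    then have "Q z * ln (1 + w z + Q z) \<le> Q z * ln N"
      using Q0 by (intro mult_left_mono) auto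
    moreover have "(w z)\<^sup>2 \<le> (18 * \<delta>)\<^sup>2"
      using w[of z] by (intro power2_le_iff_abs_le[THEN iffD2]) auto
    ultimately show ?thesis
      unfolding eq using rel_ent_perturb[OF pos Q0[of z]] by linarith
  qed
  then have "(\<Sum>z\<in>?I. rel_ent (conv n u v z / N)) \<le> (\<Sum>z\<in>?I. (18 * \<delta>)\<^sup>2 + Q z * ln N)"
    by (intro sum_mono)
  also have "\<dots> = N * (18 * \<delta>)\<^sup>2 + (\<Sum>z\<in>?I. Q z) * ln N"
    using n by (simp add: sum.distrib sum_distrib_right N_def)
  also have "\<dots> \<le> N * (18 * \<delta>)\<^sup>2 + N * (36 * \<delta>\<^sup>2) * ln N"
    using sumQ N by (intro add_left_mono mult_right_mono) auto
  finally show ?thesis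
    by (simp add: N_def power_mult_distrib algebra_simps)
qed

text \<open>The terms \<open>- z + 1\<close> cancel because the density has mean 1; what remains is
  n times the divergence ln n - H(X).\<close>

lemma sum_rel_ent_density:
  assumes n: "n > 0" and nn: "\<And>x. f x \<ge> 0" and F: "mass n f > 0"
  shows "(\<Sum>x\<in>{0..<n}. rel_ent (of_int n * f x / mass n f)) = of_int n * (neg_ent n f / mass n f + ln (of_int n))"
proof -
  let ?F = "mass n f" and ?N = "real_of_int n"
  have "rel_ent (?N * f x / ?F) = ?N / ?F * (f x * ln (f x / ?F)) + ?N * ln ?N / ?F * f x - ?N / ?F * f x + 1" for x
  proof (cases "f x = 0")
    case True
    then show ?thesis by (simp add: rel_ent_def)
  next
    case False
    then have "f x > 0" using nn by (simp add: less_le)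
    then show ?thesis
      using n F by (simp add: rel_ent_def ln_div ln_mult algebra_simps add_divide_distrib)
  qed
  then have "(\<Sum>x\<in>{0..<n}. rel_ent (?N * f x / ?F))
      = ?N / ?F * neg_ent n f + ?N * ln ?N / ?F * ?F - ?N / ?F * ?F + ?N"
    using n by (simp add: sum.distrib sum_subtractf neg_ent_def sum_distrib_left mass_def)
  then show ?thesis using F by (simp add: field_simps)
qed

text \<open>The quadratic gain of \<open>sum_rel_ent_conv_le\<close> restated for entropies: the
  density of \<open>conv n f g\<close> is the convolution of the densities divided by
  \<open>n\<close>.\<close>

lemma neg_ent_conv_near_uniform:
  assumes n: "n > 0" and per: "periodic_mod n f" "periodic_mod n g"
    and f: "\<And>x. f x \<ge> 0" and g: "\<And>x. g x \<ge> 0" and F: "mass n f > 0" and G: "mass n g > 0"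
    and ent: "neg_ent n f / mass n f + ln (of_int n) \<le> \<delta>" "neg_ent n g / mass n g + ln (of_int n) \<le> \<delta>"
    and \<delta>: "18 * \<delta> < 1"
  shows "neg_ent n (conv n f g) / (mass n f * mass n g) + ln (of_int n) \<le> \<delta>\<^sup>2 * (324 + 36 * ln (of_int n))"
proof -
  let ?N = "real_of_int n"
  define u v where "u = (\<lambda>x. ?N * f x / mass n f)" and "v = (\<lambda>x. ?N * g x / mass n g)"
  have N: "?N > 0" using n by simp
  have mu: "mass n u = ?N" "mass n v = ?N"
    using F G by (simp_all add: u_def v_def mass_def sum_divide_distrib[symmetric] sum_distrib_left[symmetric])
  have eu: "(\<Sum>x\<in>{0..<n}. rel_ent (u x)) \<le> ?N * \<delta>" "(\<Sum>x\<in>{0..<n}. rel_ent (v x)) \<le> ?N * \<delta>"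
    unfolding u_def v_def sum_rel_ent_density[OF n f F] sum_rel_ent_density[OF n g G]
    using N ent by (auto intro: mult_left_mono)
  have c: "conv n u v z / ?N = ?N * conv n f g z / mass n (conv n f g)" for z
    using N F G by (simp add: mass_conv[OF n per(2)] conv_def u_def v_def sum_divide_distrib sum_distrib_left
        mult.assoc mult.left_commute)
  have pu: "periodic_mod n u" "periodic_mod n v" and nu: "u x \<ge> 0" "v x \<ge> 0" for x
    using per f g F G n by (auto simp: periodic_mod_def u_def v_def)
  have "(\<Sum>z\<in>{0..<n}. rel_ent (?N * conv n f g z / mass n (conv n f g))) \<le> ?N * (\<delta>\<^sup>2 * (324 + 36 * ln ?N))"
    using sum_rel_ent_conv_le[OF n pu nu mu eu \<delta>] by (simp only: c)
  then show ?thesis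
    using N F G n by (subst (asm) sum_rel_ent_density) (auto simp: conv_nonneg f g mass_conv[OF n per(2)])
qed

section \<open>Loss at a single prime\<close>

text \<open>Missing one class caps each entropy at \<open>ln (n - 1)\<close>. Relative to
  \<open>2 * a * ln (n - 1) - ln n\<close> the loss is \<open>ln n - ln (n - 1)\<close>.\<close>

lemma conv_ent_bound_avoid:
  assumes n: "n > 1" and a: "a \<ge> 1 / 2" and per: "periodic_mod n f" "periodic_mod n g"
    and nn: "\<And>x. f x \<ge> 0" "\<And>x. g x \<ge> 0" and z: "\<exists>x. f x = 0" "\<exists>x. g x = 0"
  shows "conv_ent_bound n a ((2 * a - 1) * ln (of_int n - 1)) f g"
proof -
  obtain x y where "f x = 0" "g y = 0" using z by auto
  then show ?thesis
    using assms neg_ent_ge_avoid[of f n x] neg_ent_ge_avoid[of g n y]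
    by (intro conv_ent_bound_trivial) auto
qed

text \<open>The total deficit of both variables is compared with the loss of the trivial bound: a
  large deficit times \<open>1 / L\<close> covers it, a small one makes both laws nearly uniform on
  all classes.\<close>

lemma conv_ent_bound_avoid_large:
  fixes L :: real
  assumes n: "n > 1" and L: "L \<ge> 1" "72 * L < of_int n" and a: "a = 1 / 2 + 1 / L"
    and per: "periodic_mod n f" "periodic_mod n g"
    and f: "\<And>x. f x \<ge> 0" and g: "\<And>x. g x \<ge> 0" and z: "\<exists>x. f x = 0" "\<exists>x. g x = 0"
  shows "conv_ent_bound n a (2 * a * ln (of_int n - 1) - ln (of_int n)
           + 11520 * L\<^sup>2 / (of_int n * sqrt (of_int n))) f g"
    (is "conv_ent_bound n a (_ + ?c) f g")
proof (cases "mass n f * mass n g = 0")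
  case True
  have "a \<ge> 1 / 2" using a L by simp
  from conv_ent_bound_avoid[OF n this per f g z] True show ?thesis
    by (auto simp: conv_ent_bound_def)
next
  case False
  define N where "N = real_of_int n"
  have N: "N \<ge> 2" "N > 72 * L" using n L by (auto simp: N_def)
  have FG: "mass n f > 0" "mass n g > 0"
    using False mass_nonneg[of f n, OF f] mass_nonneg[of g n, OF g] by (auto simp: less_le)
  \<comment> \<open>The deficits D(X) and D(Y) against the uniform law on \<open>n - 1\<close>
    classes; adding \<open>t\<close> below turns them into divergences from the uniform law on all
    \<open>n\<close> classes.\<close>
  define x y where "x = neg_ent n f / mass n f + ln (N - 1)" and "y = neg_ent n g / mass n g + ln (N - 1)"
  define t where "t = ln N - ln (N - 1)"
  define h where "h = neg_ent n (conv n f g) / (mass n f * mass n g)"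
  have c0: "?c \<ge> 0" using N by (simp add: N_def)
  obtain i j where ij: "f i = 0" "g j = 0" using z by auto
  have "x \<ge> 0"
    using neg_ent_ge_avoid[of f n i, OF f n per(1) ij(1)] FG by (simp add: x_def N_def field_simps)
  have "y \<ge> 0"
    using neg_ent_ge_avoid[of g n j, OF g n per(2) ij(2)] FG by (simp add: y_def N_def field_simps)
  have "t = ln (N / (N - 1))" using N by (simp add: t_def ln_div)
  also have "\<dots> \<le> N / (N - 1) - 1" using N by (intro ln_le_minus_one) auto
  also have "\<dots> = 1 / (N - 1)" using N by (simp add: field_simps)
  also have "\<dots> \<le> 2 / N" using N by (simp add: field_simps)
  finally have t: "t \<le> 2 / N" .
  have t0: "t \<ge> 0" using N by (simp add: t_def)
  have "h \<le> a * (x + y) - ln N + ?c"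
  proof (cases "t \<le> (x + y) / L")
    case True
    have "conv_ent_bound n (1 / 2) ((2 * (1 / 2) - 1) * ln (of_int n - 1)) f g"
      by (rule conv_ent_bound_avoid) (use assms in auto)
    then have "h \<le> (x + y) / 2 - ln (N - 1)"
      using FG by (simp add: conv_ent_bound_def h_def x_def y_def field_simps)
    also have "\<dots> = (x + y) / 2 + t - ln N" by (simp add: t_def)
    also have "\<dots> \<le> (x + y) / 2 + (x + y) / L - ln N" using True by simp
    also have "\<dots> = a * (x + y) - ln N" by (simp add: a algebra_simps add_divide_distrib)
    finally show ?thesis using c0 by linarith
  next
    case False
    \<comment> \<open>From \<open>x + y < L * t\<close>, \<open>t \<le> 2 / N\<close> and
      \<open>L \<ge> 1\<close>. The assumption \<open>72 * L < of_int n\<close> is precisely 18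
      \<delta> < 1.\<close>
    define \<delta> where "\<delta> = 4 * L / N"
    have "x + y \<le> L * t" using False L by (simp add: field_simps)
    moreover have "L * t + t \<le> 2 * L * (2 / N)"
    proof -
      have "(L + 1) * t \<le> (2 * L) * (2 / N)" using L t t0 by (intro mult_mono) auto
      then show ?thesis by (simp add: algebra_simps)
    qed
    ultimately have "x + t \<le> \<delta>" "y + t \<le> \<delta>"
      using \<open>x \<ge> 0\<close> \<open>y \<ge> 0\<close> by (simp_all add: \<delta>_def)
    then have D: "neg_ent n f / mass n f + ln (of_int n) \<le> \<delta>" "neg_ent n g / mass n g + ln (of_int n) \<le> \<delta>"
      by (simp_all add: x_def y_def t_def N_def)
    have "18 * \<delta> < 1" using N L by (simp add: \<delta>_def field_simps)
    from neg_ent_conv_near_uniform[OF _ per f g FG D this] n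
    have "h + ln N \<le> \<delta>\<^sup>2 * (324 + 36 * ln N)" by (simp add: h_def N_def)
    \<comment> \<open>Trading the logarithm for \<open>sqrt N\<close> leaves the summable decay of
      order -3/2; the constant is 16 * 720 = 11520.\<close>
    also have "\<dots> \<le> \<delta>\<^sup>2 * (720 * sqrt N)"
    proof -
      have "ln (sqrt N) \<le> sqrt N - 1" using N by (intro ln_le_minus_one) auto
      then have "ln N \<le> 2 * sqrt N - 2" using N by (simp add: ln_sqrt)
      moreover have "sqrt N \<ge> 1" using N by simp
      ultimately have "324 + 36 * ln N \<le> 720 * sqrt N" by linarith
      then show ?thesis by (intro mult_left_mono) auto
    qed
    also have "\<dots> = 11520 * L\<^sup>2 * sqrt N / N\<^sup>2"
      by (simp add: \<delta>_def power_divide power_mult_distrib)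
    also have "sqrt N / N\<^sup>2 = 1 / (N * sqrt N)"
      using N real_sqrt_mult_self[of N] by (simp add: field_simps power2_eq_square)
    then have "11520 * L\<^sup>2 * sqrt N / N\<^sup>2 = ?c"
      unfolding N_def times_divide_eq_right[symmetric] by simp
    finally have "h \<le> ?c - ln N" by simp
    moreover have "a * (x + y) \<ge> 0"
      using a L \<open>x \<ge> 0\<close> \<open>y \<ge> 0\<close> by simp
    ultimately show ?thesis by linarith
  qed
  then have "mass n f * mass n g * h \<le> mass n f * mass n g * (a * (x + y) - ln N + ?c)"
    using FG by (intro mult_left_mono) auto
  also have "mass n f * mass n g * h = neg_ent n (conv n f g)"
    using FG by (simp add: h_def)
  also have "mass n f * mass n g * (a * (x + y) - ln N + ?c) =
      a * (mass n g * (mass n f * x) + mass n f * (mass n g * y)) + mass n f * mass n g * (?c - ln N)"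
    by (simp add: algebra_simps)
  also have "mass n f * x = neg_ent n f + mass n f * ln (N - 1)"
    using FG by (simp add: x_def algebra_simps)
  also have "mass n g * y = neg_ent n g + mass n g * ln (N - 1)"
    using FG by (simp add: y_def algebra_simps)
  finally show ?thesis
    unfolding conv_ent_bound_def N_def[symmetric] by (simp add: algebra_simps)
qed

section \<open>Summing the losses over the primes\<close>

text \<open>Up to \<open>P\<close> the loss of the trivial bound, beyond \<open>P\<close> that of
  the nearly uniform case. It is defined at all integers so that the sum over primes can be enlarged
  to a telescoping one.\<close>

definition prime_loss :: "nat \<Rightarrow> real \<Rightarrow> nat \<Rightarrow> real" where
  "prime_loss P K n = (if n \<le> P then ln (real n) - ln (real n - 1) else K / (real n * sqrt (real n)))"

text \<open>Telescoping form of the integral test for the exponent -3/2; rationalising the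
  difference of roots gives \<open>2 / (s * t * (t + s))\<close>.\<close>

lemma inverse_three_halves_le:
  fixes x :: real
  assumes "x \<ge> 1"
  shows "1 / ((x + 1) * sqrt (x + 1)) \<le> 2 / sqrt x - 2 / sqrt (x + 1)"
proof -
  define s t where "s = sqrt x" and "t = sqrt (x + 1)"
  have st: "s > 0" "t > 0" "s \<le> t" and t2: "x + 1 = t * t" and d: "(t - s) * (t + s) = 1"
    using assms by (auto simp: s_def t_def algebra_simps)
  have "1 / (t * t * t) \<le> 2 / (s * t * (t + s))"
  proof -
    have "s * t * (t + s) \<le> t * t * (t + t)"
      using st by (intro mult_mono) auto
    then have "2 / (t * t * (t + t)) \<le> 2 / (s * t * (t + s))"
      using st by (intro divide_left_mono) auto
    then show ?thesis using st by (simp add: field_simps)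
  qed
  also have "2 / (s * t * (t + s)) = 2 * ((t - s) * (t + s)) / (s * t * (t + s))" by (simp add: d)
  also have "\<dots> = 2 * (t - s) / (s * t)"
    using st by simp
  also have "\<dots> = 2 / s - 2 / t"
    using st by (simp add: field_simps)
  finally show ?thesis using st by (simp add: t2 s_def[symmetric] t_def[symmetric] mult.assoc)
qed

lemma sum_prime_loss_le:
  assumes P: "P \<ge> 1" and K: "K \<ge> 0" and m: "m \<ge> 1"
  shows "(\<Sum>n\<in>{2..m}. prime_loss P K n) \<le> ln (real P) + 2 * K / sqrt (real P)"
proof -
  \<comment> \<open>The telescoped majorant; its two branches agree at \<open>m = P\<close>, so the
    increments match across the threshold.\<close>
  define T where "T = (\<lambda>m::nat. if m \<le> P then ln (real m) else ln (real P) + 2 * K / sqrt (real P) - 2 * K / sqrt (real m))"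
  have "(\<Sum>n\<in>{2..m}. prime_loss P K n) \<le> T m"
    using m
  proof (induction m rule: dec_induct)
    case base
    then show ?case using P by (simp add: T_def)
  next
    case (step m)
    have "prime_loss P K (Suc m) \<le> T (Suc m) - T m"
    proof (cases "Suc m \<le> P")
      case True
      then show ?thesis by (simp add: T_def prime_loss_def)
    next
      case False
      have "T m = ln (real P) + 2 * K / sqrt (real P) - 2 * K / sqrt (real m)"
        using False by (cases "m = P") (auto simp: T_def)
      then have "T (Suc m) - T m = K * (2 / sqrt (real m) - 2 / sqrt (real m + 1))"
        using False by (simp add: T_def algebra_simps)
      also have "\<dots> \<ge> K * (1 / ((real m + 1) * sqrt (real m + 1)))"
        using K step.hyps by (intro mult_left_mono inverse_three_halves_le) auto
      finally show ?thesis using False by (simp add: prime_loss_def add.commute)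
    qed
    moreover have "{2..Suc m} = insert (Suc m) {2..m}" using step.hyps by auto
    ultimately show ?case using step.IH by simp
  qed
  also have "\<dots> \<le> ln (real P) + 2 * K / sqrt (real P)"
  proof (cases "m \<le> P")
    case True
    have "ln (real m) \<le> ln (real P)" using True m by simp
    then show ?thesis using True K by (simp add: T_def add_increasing2)
  next
    case False
    then show ?thesis using K by (simp add: T_def)
  qed
  finally show ?thesis .
qed

section \<open>From entropy to the size of the sumset\<close>

text \<open>Take X and Y uniform on \<open>B\<close>: then H(X) = H(Y) = ln |B|, while X + Y is
  supported on the sumset and so has entropy at most the logarithm of its size.\<close>

lemma ln_card_sumset_ge:
  fixes c :: "nat \<Rightarrow> real"
  assumes m: "m > 0" and B: "B \<subseteq> reduced_residues m" "B \<noteq> {}"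
    and bound: "\<And>f g. periodic_mod (int m) f \<Longrightarrow> periodic_mod (int m) g \<Longrightarrow>
        (\<And>x. f x \<ge> 0) \<Longrightarrow> (\<And>x. g x \<ge> 0) \<Longrightarrow>
        (\<And>x. \<not> coprime x (int m) \<Longrightarrow> f x = 0) \<Longrightarrow> (\<And>x. \<not> coprime x (int m) \<Longrightarrow> g x = 0) \<Longrightarrow>
        conv_ent_bound (int m) a K f g"
  shows "card (B <+>\<^bsub>residue_ring (int m)\<^esub> B) > 0"
    and "ln (real (card (B <+>\<^bsub>residue_ring (int m)\<^esub> B))) \<ge> 2 * a * ln (real (card B)) - K"
proof -
  let ?S = "B <+>\<^bsub>residue_ring (int m)\<^esub> B"
  let ?n = "int m"
  define f where "f = (\<lambda>x. if x mod ?n \<in> B then 1 else 0 :: real)"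
  have sub: "B \<subseteq> {0..<?n}"
    using B(1) by (auto simp: reduced_residues_def residue_ring_def)
  then have finB: "finite B" by (rule finite_subset) simp
  have cB: "card B > 0" using finB B(2) by (simp add: card_gt_0_iff)
  have S: "?S = {(x + y) mod ?n |x y. x \<in> B \<and> y \<in> B}"
    by (auto simp: set_add_def set_mult_def residue_ring_def)
  then have S2: "?S = (\<lambda>(x, y). (x + y) mod ?n) ` (B \<times> B)" by auto
  have finS: "finite ?S" unfolding S2 using finB by simp
  have "?S \<noteq> {}" unfolding S2 using B(2) by simp
  then show cS: "card ?S > 0" using finS by (simp add: card_gt_0_iff)
  have fB: "f x = (if x \<in> B then 1 else 0)" if "x \<in> {0..<?n}" for x
    using that by (simp add: f_def)
  have mass: "mass ?n f = real (card B)"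
  proof -
    have "mass ?n f = (\<Sum>x\<in>{0..<?n}. if x \<in> B then 1 else 0)"
      unfolding mass_def by (intro sum.cong refl fB)
    also have "\<dots> = real (card B)"
      using sub by (simp add: sum.If_cases Int_absorb1)
    finally show ?thesis .
  qed
  have ent: "neg_ent ?n f = - real (card B) * ln (real (card B))"
  proof -
    have "neg_ent ?n f = (\<Sum>x\<in>{0..<?n}. f x * ln (1 / real (card B)))"
      unfolding neg_ent_def mass by (intro sum.cong refl) (simp add: f_def)
    also have "\<dots> = mass ?n f * ln (1 / real (card B))"
      by (simp add: mass_def sum_distrib_right)
    finally show ?thesis using cB by (simp add: mass ln_div)
  qed
  have per: "periodic_mod ?n f" by (simp add: periodic_mod_def f_def)
  have nn: "f x \<ge> 0" for x by (simp add: f_def)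
  have cop: "f x = 0" if "\<not> coprime x ?n" for x
    using that B(1) m by (auto simp: f_def reduced_residues_def)
  have supp: "z \<in> ?S" if z: "z \<in> {0..<?n}" "conv ?n f f z \<noteq> 0" for z
  proof -
    obtain x where "x \<in> {0..<?n}" "f x * f (z - x) \<noteq> 0"
      using z(2) unfolding conv_def by (meson sum.not_neutral_contains_not_neutral)
    then have x: "x mod ?n \<in> B" "(z - x) mod ?n \<in> B"
      by (auto simp: f_def split: if_splits)
    have "z = (x mod ?n + (z - x) mod ?n) mod ?n"
      using z(1) by (simp add: mod_simps)
    then show ?thesis unfolding S using x by blast
  qed
  have "- mass ?n (conv ?n f f) * ln (real (card ?S)) \<le> neg_ent ?n (conv ?n f f)"
    using finS cS supp nn by (intro neg_ent_ge_support[of _ ?S] conv_nonneg) auto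
  also have "\<dots> \<le> a * (mass ?n f * neg_ent ?n f + mass ?n f * neg_ent ?n f) + mass ?n f * mass ?n f * K"
    using bound[of f f] per nn cop by (simp add: conv_ent_bound_def)
  also have "mass ?n (conv ?n f f) = real (card B) * real (card B)"
    using m per by (simp add: mass_conv mass)
  finally have "(real (card B) * real (card B)) * (2 * a * ln (real (card B)) - K)
      \<le> (real (card B) * real (card B)) * ln (real (card ?S))"
    by (simp add: mass ent algebra_simps)
  then show "ln (real (card ?S)) \<ge> 2 * a * ln (real (card B)) - K"
    using cB by (simp add: mult_le_cancel_left_pos)
qed

lemma conv_ent_bound_reduced_residues:
  fixes L :: nat
  assumes L: "L \<ge> 1" and m: "m > 0" and a: "a = 1 / 2 + 1 / real L"
    and per: "periodic_mod (int m) f" "periodic_mod (int m) g"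
    and nn: "\<And>x. f x \<ge> 0" "\<And>x. g x \<ge> 0"
    and supp: "\<And>x. \<not> coprime x (int m) \<Longrightarrow> f x = 0" "\<And>x. \<not> coprime x (int m) \<Longrightarrow> g x = 0"
  shows "conv_ent_bound (int m) a (2 * a * ln (real (totient m)) - ln (real m) + (ln (72 * real L ^ 4) + 2880)) f g"
proof -
  \<comment> \<open>Large enough for \<open>72 * L \<le> P\<close>, as the nearly uniform case
    requires, and for \<open>sqrt P \<ge> 8 * L\<^sup>2\<close>, which bounds the tail by 2 * 11520
    / 8 = 2880.\<close>
  define P where "P = 72 * L ^ 4"
  define c where "c = prime_loss P (11520 * (real L)\<^sup>2)"
  have a2: "a \<ge> 1 / 2" using a by simp
  have LP: "72 * L \<le> P" unfolding P_def using L by (simp add: self_le_power)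
  have prime: "conv_ent_bound (int p) a (2 * a * ln (real p - 1) - ln (real p) + c p) f g"
    if p: "prime p" and pg: "periodic_mod (int p) f" "periodic_mod (int p) g"
      "\<And>x. f x \<ge> 0" "\<And>x. g x \<ge> 0" "\<exists>x. f x = 0" "\<exists>x. g x = 0" for p f g
  proof (cases "p \<le> P")
    case True
    have "conv_ent_bound (int p) a ((2 * a - 1) * ln (of_int (int p) - 1)) f g"
      using prime_gt_1_nat[OF p] a2 pg by (intro conv_ent_bound_avoid) auto
    then show ?thesis using True by (simp add: c_def prime_loss_def algebra_simps)
  next
    case False
    then have "72 * L < p" using LP by simp
    then have "72 * real L < real p" by linarith
    then show ?thesis
      using conv_ent_bound_avoid_large[of "int p" "real L" a f g] prime_gt_1_nat[OF p] a pg L False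
      by (simp add: c_def prime_loss_def)
  qed
  \<comment> \<open>Passing to all integers costs \<open>ln P\<close> in total, a power of
    \<open>L\<close> after exponentiation.\<close>
  have "(\<Sum>p\<in>prime_factors m. c p) \<le> (\<Sum>p\<in>{2..m}. c p)"
  proof (rule sum_mono2)
    show "prime_factors m \<subseteq> {2..m}"
      using m by (auto simp: prime_factors_dvd prime_ge_2_nat dvd_imp_le)
    show "0 \<le> c p" if "p \<in> {2..m} - prime_factors m" for p
      using that by (auto simp: c_def prime_loss_def)
  qed simp
  also have "\<dots> \<le> ln (real P) + 2 * (11520 * (real L)\<^sup>2) / sqrt (real P)"
    unfolding c_def using L m by (intro sum_prime_loss_le) (auto simp: P_def)
  also have "\<dots> \<le> ln (72 * real L ^ 4) + 2880"
  proof -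
    have "8 * (real L)\<^sup>2 \<le> sqrt (real P)"
      by (intro real_le_rsqrt) (simp add: P_def power_mult_distrib flip: power_mult)
    moreover have "real P > 0" using L by (simp add: P_def)
    ultimately have "2 * (11520 * (real L)\<^sup>2) / sqrt (real P) \<le> 2880"
      by (simp add: field_simps)
    then show ?thesis by (simp add: P_def)
  qed
  finally have c: "(\<Sum>p\<in>prime_factors m. c p) \<le> ln (72 * real L ^ 4) + 2880" .
  have "conv_ent_bound (int m) a (2 * a * ln (real (totient m)) - ln (real m) + (\<Sum>p\<in>prime_factors m. c p)) f g"
    by (rule conv_ent_bound_coprime[OF a2 prime]) (use m per nn supp in auto)
  moreover have "mass (int m) f * mass (int m) g * (2 * a * ln (real (totient m)) - ln (real m) + (\<Sum>p\<in>prime_factors m. c p))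
      \<le> mass (int m) f * mass (int m) g * (2 * a * ln (real (totient m)) - ln (real m) + (ln (72 * real L ^ 4) + 2880))"
    using c nn by (intro mult_left_mono mult_nonneg_nonneg mass_nonneg) auto
  ultimately show ?thesis
    unfolding conv_ent_bound_def by linarith
qed

section \<open>Comparison with the required bound and conclusion\<close>

text \<open>For t < 1 the cube root is negative and the exponent positive, but then it is still at most 6.\<close>

lemma quartic_le_subexponential:
  fixes t :: real
  assumes "t > 0"
  shows "(t + 1) ^ 4 * exp (- 6 * t powr (2 / 3) * root 3 (ln t)) \<le> 256 * exp 6"
proof (cases "t \<ge> 3")
  case True
  \<comment> \<open>As q^6 = t^4 and \<open>ln t \<ge> 1\<close>, the exponential is at most exp (-6
    q) \<le> q^(-6) = t^(-4). This fixes the constant 6 in the exponent.\<close>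
  define q where "q = t powr (2 / 3)"
  have q0: "q > 0" using assms by (simp add: q_def)
  have "q ^ 6 = q powr 6" using q0 by (simp add: powr_numeral)
  also have "\<dots> = t powr 4" by (simp add: q_def powr_powr)
  also have "\<dots> = t ^ 4" using assms by (simp add: powr_numeral)
  finally have q: "q > 0" "q ^ 6 = t ^ 4" using q0 by auto
  have "exp 1 \<le> t" using exp_le True by linarith
  then have "1 \<le> ln t" using assms by (simp add: ln_ge_iff)
  then have "root 3 1 \<le> root 3 (ln t)" by (subst real_root_le_iff) auto
  then have "q * 1 \<le> q * root 3 (ln t)" using q by (intro mult_left_mono) auto
  then have "exp (- 6 * q * root 3 (ln t)) \<le> exp (6 * (- q))" by simp
  also have "\<dots> = exp (- q) ^ 6" using exp_of_nat_mult[of 6 "- q"] by simp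
  also have "\<dots> \<le> (1 / q) ^ 6"
  proof (intro power_mono)
    have "q \<le> exp q" using exp_ge_add_one_self[of q] by linarith
    then show "exp (- q) \<le> 1 / q" using q by (simp add: exp_minus field_simps)
  qed auto
  also have "\<dots> = 1 / t ^ 4" using q by (simp add: power_one_over)
  finally have "(t + 1) ^ 4 * exp (- 6 * q * root 3 (ln t)) \<le> (2 * t) ^ 4 * (1 / t ^ 4)"
    using True by (intro mult_mono power_mono) auto
  also have "\<dots> = 16" using True by (simp add: power_mult_distrib)
  also have "\<dots> \<le> 256 * exp (6::real)" using one_le_exp_iff[of "6::real"] by linarith
  finally show ?thesis by (simp add: q_def)
next
  case False
  have "- (t powr (2 / 3) * root 3 (ln t)) \<le> 1"
  proof (cases "t \<ge> 1")
    case True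
    then have "0 \<le> t powr (2 / 3) * root 3 (ln t)" by (intro mult_nonneg_nonneg) auto
    then show ?thesis by simp
  next
    case False
    \<comment> \<open>The logarithm of \<open>1 / t\<close> is at most \<open>1 / t\<close>, so the
      product is at most t^(1/3) \<le> 1.\<close>
    have "- root 3 (ln t) = root 3 (ln (1 / t))"
      using assms by (simp add: ln_div real_root_minus)
    also have "\<dots> \<le> root 3 (1 / t)"
      using assms ln_le_minus_one[of "1 / t"] by (subst real_root_le_iff) auto
    also have "\<dots> = t powr (- 1 / 3)"
      using assms by (simp add: root_powr_inverse powr_divide powr_minus_divide)
    finally have "t powr (2 / 3) * (- root 3 (ln t)) \<le> t powr (2 / 3) * t powr (- 1 / 3)"
      by (intro mult_left_mono) auto
    also have "\<dots> = t powr (1 / 3)" by (simp flip: powr_add)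
    also have "\<dots> \<le> 1" using assms False by (intro powr_le1) auto
    finally show ?thesis by simp
  qed
  then have "exp (- 6 * t powr (2 / 3) * root 3 (ln t)) \<le> exp 6" by simp
  moreover have "(t + 1) ^ 4 \<le> 4 ^ 4" using assms False by (intro power_mono) auto
  ultimately have "(t + 1) ^ 4 * exp (- 6 * t powr (2 / 3) * root 3 (ln t)) \<le> 4 ^ 4 * exp 6"
    by (intro mult_mono) auto
  then show ?thesis by simp
qed

lemma card_sumset_ge:
  fixes \<alpha> :: real
  assumes \<alpha>: "0 < \<alpha>" "\<alpha> < 1" and m: "m > 0"
    and B: "B \<subseteq> reduced_residues m" "\<alpha> * real (totient m) \<le> real (card B)"
  shows "\<alpha> * real m * exp (- 2882) \<le> 72 * (ln (1 / \<alpha>) + 1) ^ 4 * real (card (B <+>\<^bsub>residue_ring (int m)\<^esub> B))"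
proof -
  let ?S = "B <+>\<^bsub>residue_ring (int m)\<^esub> B"
  define t where "t = ln (1 / \<alpha>)"
  have t: "t > 0" "ln \<alpha> = - t" using \<alpha> by (simp_all add: t_def ln_div)
  \<comment> \<open>With \<open>L \<ge> t\<close> the coefficient satisfies 2 a t = t + 2 t / L
    \<le> t + 2, so the slack costs a constant and 2882 = 2880 + 2; \<open>L \<le> t + 1\<close>
    keeps the factor L^4 polynomial in \<open>t\<close>.\<close>
  define L where "L = nat \<lceil>t\<rceil>"
  define a where "a = 1 / 2 + 1 / real L"
  have L: "L \<ge> 1" "t \<le> real L" "real L \<le> t + 1"
    using t(1) by (auto simp: L_def; linarith)+
  have \<phi>: "real (totient m) > 0" using m by simp
  then have cB: "real (card B) > 0" using B(2) \<alpha> by (smt (verit) mult_pos_pos)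
  then have Bne: "B \<noteq> {}" by auto
  have bound: "conv_ent_bound (int m) a (2 * a * ln (real (totient m)) - ln (real m) + (ln (72 * real L ^ 4) + 2880)) f g"
    if "periodic_mod (int m) f" "periodic_mod (int m) g" "\<And>x. f x \<ge> 0" "\<And>x. g x \<ge> 0"
      "\<And>x. \<not> coprime x (int m) \<Longrightarrow> f x = 0" "\<And>x. \<not> coprime x (int m) \<Longrightarrow> g x = 0" for f g
    by (rule conv_ent_bound_reduced_residues[OF L(1) m a_def]) (use that in auto)
  have S0: "card ?S > 0"
    by (rule ln_card_sumset_ge(1)[OF m B(1) Bne bound])
  have S: "ln (real (card ?S)) \<ge> 2 * a * ln (real (card B))
      - (2 * a * ln (real (totient m)) - ln (real m) + (ln (72 * real L ^ 4) + 2880))"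
    by (rule ln_card_sumset_ge(2)[OF m B(1) Bne bound])
  have "ln (\<alpha> * real (totient m)) \<le> ln (real (card B))"
    using B(2) \<alpha> \<phi> cB by (subst ln_le_cancel_iff) auto
  then have "- t + ln (real (totient m)) \<le> ln (real (card B))"
    using \<alpha> \<phi> t by (simp add: ln_mult)
  then have "2 * a * (- t + ln (real (totient m))) \<le> 2 * a * ln (real (card B))"
    by (intro mult_left_mono) (auto simp: a_def)
  moreover have "2 * a * t \<le> t + 2"
    using L by (simp add: a_def field_simps)
  ultimately have "ln (real m) - t - 2882 - ln (72 * real L ^ 4) \<le> ln (real (card ?S))"
    using S by (simp add: algebra_simps)
  then have "ln \<alpha> + ln (real m) + (- 2882) \<le> ln (72 * real L ^ 4) + ln (real (card ?S))"
    using t by simp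
  moreover have "ln (\<alpha> * real m * exp (- 2882)) = ln \<alpha> + ln (real m) + (- 2882)"
    using \<alpha> m by (simp add: ln_mult)
  moreover have "ln (72 * real L ^ 4 * real (card ?S)) = ln (72 * real L ^ 4) + ln (real (card ?S))"
    using L(1) S0 by (intro ln_mult_pos) auto
  ultimately have "ln (\<alpha> * real m * exp (- 2882)) \<le> ln (72 * real L ^ 4 * real (card ?S))"
    by linarith
  then have "\<alpha> * real m * exp (- 2882) \<le> 72 * real L ^ 4 * real (card ?S)"
    using \<alpha> m L(1) S0 by (subst (asm) ln_le_cancel_iff) auto
  also have "\<dots> \<le> 72 * (t + 1) ^ 4 * real (card ?S)"
    using L(3) by (intro mult_right_mono mult_left_mono power_mono) auto
  finally show ?thesis by (simp add: t_def)
qed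

theorem theorem1p3:
  "\<exists>C1 C2 :: real. C1 > 0 \<and> C2 > 0 \<and>
     (\<forall>\<alpha> :: real. 0 < \<alpha> \<and> \<alpha> < 1 \<longrightarrow>
       (\<exists>M :: nat. \<forall>m :: nat. m > 0 \<and> m \<ge> M \<longrightarrow>
         (\<forall>B. B \<subseteq> reduced_residues m \<and> real (card B) \<ge> \<alpha> * real (totient m) \<longrightarrow>
           real (card (B <+>\<^bsub>residue_ring (int m)\<^esub> B))
             \<ge> C1 * \<alpha> * exp (- C2 * ln (1 / \<alpha>) powr (2 / 3) * root 3 (ln (ln (1 / \<alpha>)))) * real m)))"
proof (rule exI[of _ "exp (- 2888) / 18432"], rule exI[of _ 6], intro conjI allI impI exI[of _ 0])
  \<comment> \<open>Origin of the witnesses: 2888 = 2882 + 6 and 18432 = 72 * 256 combine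
    \<open>card_sumset_ge\<close> with \<open>quartic_le_subexponential\<close>. The threshold is 0
    because \<open>card_sumset_ge\<close> covers every positive \<open>m\<close>.\<close>
  fix \<alpha> :: real and m :: nat and B
  assume \<alpha>: "0 < \<alpha> \<and> \<alpha> < 1" and m: "m > 0 \<and> m \<ge> 0"
    and B: "B \<subseteq> reduced_residues m \<and> real (card B) \<ge> \<alpha> * real (totient m)"
  define t where "t = ln (1 / \<alpha>)"
  define S where "S = real (card (B <+>\<^bsub>residue_ring (int m)\<^esub> B))"
  define E where "E = exp (- 6 * t powr (2 / 3) * root 3 (ln t))"
  have t: "t > 0" using \<alpha> by (simp add: t_def)
  have "\<alpha> * real m * exp (- 2882) \<le> 72 * (t + 1) ^ 4 * S"
    unfolding t_def S_def using card_sumset_ge[of \<alpha> m B] \<alpha> m B by simp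
  then have "\<alpha> * real m * exp (- 2882) * E \<le> 72 * (t + 1) ^ 4 * S * E"
    by (intro mult_right_mono) (auto simp: E_def)
  also have "\<dots> = 72 * S * ((t + 1) ^ 4 * E)" by (simp add: algebra_simps)
  also have "\<dots> \<le> 72 * S * (256 * exp 6)"
    unfolding E_def using quartic_le_subexponential[OF t] by (intro mult_left_mono) (auto simp: S_def)
  finally have "exp (- 6) * (\<alpha> * real m * exp (- 2882) * E) \<le> exp (- 6) * (72 * S * (256 * exp 6))"
    by (intro mult_left_mono) auto
  also have "\<dots> = 18432 * S" by (simp add: exp_minus field_simps)
  also have "exp (- 6) * (\<alpha> * real m * exp (- 2882) * E) = exp (- 2888) * (\<alpha> * real m * E)"
    using exp_add[of "- 6::real" "- 2882"] by simp
  finally show "exp (- 2888) / 18432 * \<alpha> * exp (- 6 * ln (1 / \<alpha>) powr (2 / 3) * root 3 (ln (ln (1 / \<alpha>)))) * real m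
      \<le> real (card (B <+>\<^bsub>residue_ring (int m)\<^esub> B))"
    by (simp add: t_def S_def E_def algebra_simps)
qed auto

end
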